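(* Let $\mathcal{S}=\{\alpha_i\}_{i\in\omega}$ be a sequence of ordinal numbers indexed by $\omega$. Then the set $$T'(\mathcal{S})=\left\{\sum_{i\in\omega}\alpha_{\varphi(i)}\ \middle|\ \varphi:\omega\rightarrow\omega\text{ is an injection}\right\}$$ is at most countable.
   Context: The ordinal $\omega$ is identified with the set of non-negative integers. For a sequence of ordinals $\{\beta_i\}_{i\in\omega}$ (repetitions allowed), $\sum_{i\in\omega}\beta_i$ denotes the usual ordinal sum, i.e. $\sup_{n<\omega}(\beta_0+\beta_1+\dots+\beta_{n})$, with ordinal addition. The map $\varphi$ is an arbitrary injective function (not required to preserve order). "At most countable" means finite or countably infinite. *)

theory Defs
  imports
    Main
    "HOL-Algebra.Free_Abelian_Groups"  (* gives access to Order_Union and Wellorder_Constructions *)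
begin

section \<open>Ordinals as isomorphism classes of well-orders\<close>

text \<open>
  An ordinal is an isomorphism class of well-orders. HOL has no type of all ordinals, so the type
  below depends on a type parameter, and theorems about it are meant for arbitrary \<open>'a\<close>. The type
  \<open>'a ordinal\<close> consists of the order types of all well-orders on subsets of \<^typ>\<open>nat \<times> 'a\<close>;
  every well-order on a subset of \<open>'a\<close> is represented in it. The factor \<^typ>\<open>nat\<close> makes the carrier
  infinite, hence the ordinals of this type are closed under addition and countable suprema, even
  if \<open>'a\<close> is finite.
\<close>

unbundle cardinal_syntax

quotient_type 'a ordinal = "(nat \<times> 'a) rel" / partial: "\<lambda>r s. r =o s"
  morphisms rep_ordinal order_type
proof (rule part_equivpI)
  have "Well_order ({} :: (nat \<times> 'a) rel)"
    by (simp add: well_order_on_def linear_order_on_def partial_order_on_def preorder_on_def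
        refl_on_def trans_def antisym_def total_on_def)
  then show "\<exists>r :: (nat \<times> 'a) rel. r =o r"
    using ordIso_reflexive by blast
  show "symp (\<lambda>r s :: (nat \<times> 'a) rel. r =o s)"
    by (simp add: symp_def ordIso_symmetric)
  show "transp (\<lambda>r s :: (nat \<times> 'a) rel. r =o s)"
    by (meson ordIso_transitive transpI)
qed

lemma ordIso_refl_iff: "r =o r \<longleftrightarrow> Well_order r"
  using ordIso_reflexive unfolding ordIso_def by blast

lemma ex_order_type:
  fixes x :: "'a ordinal"
  obtains r where "Well_order r" "x = order_type r"
proof
  show "Well_order (rep_ordinal x)"
    using Quotient_rep_reflp[OF Quotient_ordinal, of x] by (simp add: ordIso_refl_iff)
  show "x = order_type (rep_ordinal x)"
    using Quotient_abs_rep[OF Quotient_ordinal, of x] by simp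
qed


subsection \<open>Order\<close>

instantiation ordinal :: (type) wellorder
begin

lift_definition less_eq_ordinal :: "'a ordinal \<Rightarrow> 'a ordinal \<Rightarrow> bool" is "\<lambda>r s. r \<le>o s"
  by (meson ordIso_ordLeq_trans ordIso_symmetric ordLeq_ordIso_trans)

lift_definition less_ordinal :: "'a ordinal \<Rightarrow> 'a ordinal \<Rightarrow> bool" is "\<lambda>r s. r <o s"
  by (meson ordIso_ordLess_trans ordIso_symmetric ordLess_ordIso_trans)

instance
proof
  fix x y z :: "'a ordinal"
  show "x < y \<longleftrightarrow> x \<le> y \<and> \<not> y \<le> x"
    by transfer (metis ordIso_refl_iff not_ordLeq_iff_ordLess ordLess_imp_ordLeq)
  show "x \<le> x"
    by transfer (simp add: ordIso_imp_ordLeq)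
  show "x \<le> y \<Longrightarrow> y \<le> z \<Longrightarrow> x \<le> z"
    by transfer (rule ordLeq_transitive)
  show "x \<le> y \<Longrightarrow> y \<le> x \<Longrightarrow> x = y"
    by transfer (simp add: ordIso_iff_ordLeq)
  show "x \<le> y \<or> y \<le> x"
    by transfer (simp add: ordIso_refl_iff ordLeq_total)
next
  fix P :: "'a ordinal \<Rightarrow> bool" and a :: "'a ordinal"
  assume step: "\<And>x. (\<And>y. y < x \<Longrightarrow> P y) \<Longrightarrow> P x"
  have "Well_order r \<longrightarrow> P (order_type r)" for r :: "(nat \<times> 'a) rel"
  proof (rule wf_induct[OF wf_ordLess, of "\<lambda>r. Well_order r \<longrightarrow> P (order_type r)" r])
    fix r :: "(nat \<times> 'a) rel"
    assume IH: "\<forall>s. s <o r \<longrightarrow> Well_order s \<longrightarrow> P (order_type s)"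
    show "Well_order r \<longrightarrow> P (order_type r)"
    proof (rule impI, rule step)
      fix y assume r: "Well_order r" and y: "y < order_type r"
      obtain s where s: "Well_order s" "y = order_type s"
        by (rule ex_order_type[of y])
      have "s <o r"
        using y less_ordinal.abs_eq[OF ordIso_reflexive[OF s(1)] ordIso_reflexive[OF r]]
        unfolding s(2) by blast
      then show "P y"
        using IH s by blast
    qed
  qed
  then show "P a"
    by (metis ex_order_type)
qed

end

instantiation ordinal :: (type) conditionally_complete_linorder
begin

definition inf_ordinal :: "'a ordinal \<Rightarrow> 'a ordinal \<Rightarrow> 'a ordinal" where
  "inf_ordinal = min"

definition sup_ordinal :: "'a ordinal \<Rightarrow> 'a ordinal \<Rightarrow> 'a ordinal" where
  "sup_ordinal = max"

definition Inf_ordinal :: "'a ordinal set \<Rightarrow> 'a ordinal" where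
  "Inf_ordinal A = (LEAST x. x \<in> A)"

definition Sup_ordinal :: "'a ordinal set \<Rightarrow> 'a ordinal" where
  "Sup_ordinal A = (LEAST u. \<forall>x\<in>A. x \<le> u)"

instance
proof
  fix x z :: "'a ordinal" and X :: "'a ordinal set"
  show "Inf X \<le> x" if "x \<in> X"
    using that by (simp add: Inf_ordinal_def Least_le)
  show "z \<le> Inf X" if "X \<noteq> {}" "\<And>x. x \<in> X \<Longrightarrow> z \<le> x"
    using that LeastI_ex[of "\<lambda>x. x \<in> X"] unfolding Inf_ordinal_def by blast
  show "x \<le> Sup X" if "x \<in> X" "bdd_above X"
    using that LeastI_ex[of "\<lambda>u. \<forall>x\<in>X. x \<le> u"] unfolding Sup_ordinal_def bdd_above_def by blast
  show "Sup X \<le> z" if "\<And>x. x \<in> X \<Longrightarrow> x \<le> z"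
    using that by (simp add: Least_le Sup_ordinal_def)
qed (auto simp: inf_ordinal_def sup_ordinal_def)

end


subsection \<open>Addition\<close>

text \<open>
  The ordinal sum places a copy of \<open>s\<close> after a copy of \<open>r\<close>; even and odd indices keep the two
  copies disjoint inside \<^typ>\<open>nat \<times> 'a\<close>.
\<close>

definition ord_concat :: "(nat \<times> 'a) rel \<Rightarrow> (nat \<times> 'a) rel \<Rightarrow> (nat \<times> 'a) rel" where
  "ord_concat r s =
     dir_image r (\<lambda>(n, x). (2 * n, x)) Osum dir_image s (\<lambda>(n, x). (2 * n + 1, x))"

lemma inj_even_copy: "inj_on (\<lambda>(n :: nat, x). (2 * n, x)) A"
  and inj_odd_copy: "inj_on (\<lambda>(n :: nat, x). (2 * n + 1, x)) A"
  by (auto simp: inj_on_def)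

lemma disjoint_copies:
  "Field (dir_image r (\<lambda>(n :: nat, x). (2 * n, x))) \<inter>
   Field (dir_image s (\<lambda>(n :: nat, x). (2 * n + 1, x))) = {}"
  unfolding dir_image_Field by (auto; presburger)

lemma Osum_mono_ordLeq:
  assumes "r \<le>o r'" "s \<le>o s'" "Field r \<inter> Field s = {}" "Field r' \<inter> Field s' = {}"
  shows "r Osum s \<le>o r' Osum s'"
proof -
  have wo: "Well_order r" "Well_order r'" "Well_order s" "Well_order s'"
    using assms ordLeq_Well_order_simp by blast+
  obtain f where f: "\<And>a. a \<in> Field r \<Longrightarrow> f a \<in> Field r' \<and> f ` underS r a \<subseteq> underS r' (f a)"
    using assms(1) unfolding ordLeq_def2 by blast
  obtain g where g: "\<And>a. a \<in> Field s \<Longrightarrow> g a \<in> Field s' \<and> g ` underS s a \<subseteq> underS s' (g a)"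
    using assms(2) unfolding ordLeq_def2 by blast
  define h where "h = (\<lambda>a. if a \<in> Field r then f a else g a)"
  have "h a \<in> Field (r' Osum s') \<and> h ` underS (r Osum s) a \<subseteq> underS (r' Osum s') (h a)"
    if a: "a \<in> Field (r Osum s)" for a
  proof (intro conjI subsetI)
    show "h a \<in> Field (r' Osum s')"
      using a f g by (auto simp: h_def Field_Osum)
    fix c assume "c \<in> h ` underS (r Osum s) a"
    then obtain b where b: "c = h b" "b \<noteq> a" "(b, a) \<in> r Osum s"
      by (auto simp: underS_def)
    consider "(b, a) \<in> r" | "(b, a) \<in> s" | "b \<in> Field r" "a \<in> Field s"
      using b(3) by (auto simp: Osum_def)
    then show "c \<in> underS (r' Osum s') (h a)"
    proof cases
      case 1
      then have "b \<in> Field r" "a \<in> Field r" "b \<in> underS r a"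
        using b(2) by (auto simp: underS_def Field_def)
      then have "f b \<in> underS r' (f a)" using f by blast
      with \<open>b \<in> Field r\<close> \<open>a \<in> Field r\<close> b(1) show ?thesis
        by (auto simp: h_def underS_def Osum_def)
    next
      case 2
      then have "b \<in> Field s" "a \<in> Field s" "b \<in> underS s a"
        using b(2) by (auto simp: underS_def Field_def)
      then have "g b \<in> underS s' (g a)" "b \<notin> Field r" "a \<notin> Field r"
        using g assms(3) by blast+
      with b(1) show ?thesis
        by (auto simp: h_def underS_def Osum_def)
    next
      case 3
      then have "a \<notin> Field r" "f b \<in> Field r'" "g a \<in> Field s'"
        using f g assms(3) by blast+
      with 3 b(1) assms(4) show ?thesis
        by (auto simp: h_def underS_def Osum_def)
    qed
  qed
  then show ?thesis
    unfolding ordLeq_def2 using Osum_Well_order[OF assms(3) wo(1,3)] Osum_Well_order[OF assms(4) wo(2,4)]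
    by blast
qed

lemma ord_concat_mono:
  assumes "r \<le>o r'" "s \<le>o s'"
  shows "ord_concat r s \<le>o ord_concat r' s'"
proof -
  have wo: "Well_order r" "Well_order r'" "Well_order s" "Well_order s'"
    using assms ordLeq_Well_order_simp by blast+
  have "dir_image r (\<lambda>(n, x). (2 * n, x)) \<le>o dir_image r' (\<lambda>(n, x). (2 * n, x))"
    using dir_image_ordIso[OF wo(1) inj_even_copy] dir_image_ordIso[OF wo(2) inj_even_copy] assms(1)
    by (meson ordIso_symmetric ordIso_ordLeq_trans ordLeq_ordIso_trans)
  moreover have "dir_image s (\<lambda>(n, x). (2 * n + 1, x)) \<le>o dir_image s' (\<lambda>(n, x). (2 * n + 1, x))"
    using dir_image_ordIso[OF wo(3) inj_odd_copy] dir_image_ordIso[OF wo(4) inj_odd_copy] assms(2)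
    by (meson ordIso_symmetric ordIso_ordLeq_trans ordLeq_ordIso_trans)
  ultimately show ?thesis
    unfolding ord_concat_def by (intro Osum_mono_ordLeq disjoint_copies)
qed

instantiation ordinal :: (type) plus
begin

lift_definition plus_ordinal :: "'a ordinal \<Rightarrow> 'a ordinal \<Rightarrow> 'a ordinal" is ord_concat
  by (simp add: ordIso_iff_ordLeq ord_concat_mono)

instance ..

end


subsection \<open>Sums of sequences of ordinals\<close>

primrec partial_sum :: "(nat \<Rightarrow> 'a ordinal) \<Rightarrow> nat \<Rightarrow> 'a ordinal" where
  "partial_sum \<beta> 0 = \<beta> 0"
| "partial_sum \<beta> (Suc n) = partial_sum \<beta> n + \<beta> (Suc n)"

definition ordinal_sum :: "(nat \<Rightarrow> 'a ordinal) \<Rightarrow> 'a ordinal" where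
  "ordinal_sum \<beta> = (SUP n. partial_sum \<beta> n)"

text \<open>
  The supremum above is never a junk value: every sequence in \<^typ>\<open>'a ordinal\<close> is bounded, namely
  by the order type of the lexicographic sum of representing well-orders.
\<close>

definition lex_union :: "(nat \<Rightarrow> 'b rel) \<Rightarrow> (nat \<times> 'b) rel" where
  "lex_union r = {((i, x), (j, y)). x \<in> Field (r i) \<and> y \<in> Field (r j) \<and>
                                    (i < j \<or> i = j \<and> (x, y) \<in> r i)}"

lemma Field_lex_union:
  assumes "\<And>i. Well_order (r i)"
  shows "Field (lex_union r) = {(i, x). x \<in> Field (r i)}"
proof -
  have "(x, x) \<in> r i" if "x \<in> Field (r i)" for i x
    using assms[of i] that by (auto simp: order_on_defs refl_on_def)
  then show ?thesis
    by (fastforce simp: lex_union_def Field_def)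
qed

lemma Well_order_lex_union:
  assumes wo: "\<And>i. Well_order (r i)"
  shows "Well_order (lex_union r)"
proof -
  have rl: "\<And>i x. x \<in> Field (r i) \<Longrightarrow> (x, x) \<in> r i"
    and tr: "\<And>i. trans (r i)" and an: "\<And>i. antisym (r i)"
    and to: "\<And>i. Total (r i)" and wf: "\<And>i. wf (r i - Id)"
    using wo by (auto simp: order_on_defs refl_on_def)
  have "Refl (lex_union r)"
    unfolding refl_on_def Field_lex_union[OF wo] using rl
    by (auto simp: lex_union_def)
  moreover have "trans (lex_union r)"
    using tr by (fastforce simp: lex_union_def intro!: transI dest: transD)
  moreover have "antisym (lex_union r)"
    using an by (auto simp: antisym_def lex_union_def)
  moreover have "Total (lex_union r)"
    unfolding total_on_def Field_lex_union[OF wo]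
  proof (intro ballI impI)
    fix p q assume pq: "p \<in> {(i, x). x \<in> Field (r i)}" "q \<in> {(i, x). x \<in> Field (r i)}" "p \<noteq> q"
    obtain i x j y where "p = (i, x)" "q = (j, y)"
      by fastforce
    then show "(p, q) \<in> lex_union r \<or> (q, p) \<in> lex_union r"
      using pq to[of i] by (cases i j rule: linorder_cases) (auto simp: total_on_def lex_union_def)
  qed
  moreover have "wf (lex_union r - Id)"
  proof -
    have "P (i, x)" if step: "\<And>p. (\<And>q. (q, p) \<in> lex_union r - Id \<Longrightarrow> P q) \<Longrightarrow> P p" for P i x
    proof (induction i arbitrary: x rule: less_induct)
      case (less i)
      show ?case
      proof (induction x rule: wf_induct_rule[OF wf[of i]])
        case (1 x)
        show ?case
          by (rule step) (use less 1 in \<open>auto simp: lex_union_def\<close>)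
      qed
    qed
    then show ?thesis
      unfolding wf_def by (metis surj_pair)
  qed
  ultimately show ?thesis
    by (auto simp: order_on_defs Field_def)
qed

lemma bdd_above_ordinal_sequence:
  fixes \<beta> :: "nat \<Rightarrow> 'a ordinal"
  shows "bdd_above (range \<beta>)"
proof -
  have "\<exists>r. Well_order r \<and> \<beta> i = order_type r" for i
    by (meson ex_order_type)
  then obtain r where r: "\<And>i. Well_order (r i)" "\<And>i. \<beta> i = order_type (r i)"
    by metis
  define f :: "nat \<times> nat \<times> 'a \<Rightarrow> nat \<times> 'a" where "f = (\<lambda>(i, n, x). (prod_encode (i, n), x))"
  have inj: "inj_on f A" for A
    by (auto simp: f_def inj_on_def)
  note wo = Well_order_lex_union[of r, OF r(1)]
  have "r i \<le>o lex_union r" for i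
    unfolding ordLeq_def2
  proof (intro conjI exI[of _ "Pair i"] ballI subsetI wo r(1))
    fix a assume "a \<in> Field (r i)"
    then show "(i, a) \<in> Field (lex_union r)"
      by (simp add: Field_lex_union[OF r(1)])
    fix c assume "c \<in> Pair i ` underS (r i) a"
    then show "c \<in> underS (lex_union r) (i, a)"
      by (auto simp: underS_def lex_union_def Field_def)
  qed
  then have "r i \<le>o dir_image (lex_union r) f" for i
    using dir_image_ordIso[OF wo inj] ordLeq_ordIso_trans by blast
  then have "\<beta> i \<le> order_type (dir_image (lex_union r) f)" for i
    using r Well_order_dir_image[OF wo inj]
    by (simp add: less_eq_ordinal.abs_eq ordIso_refl_iff)
  then show ?thesis
    by (auto simp: bdd_above_def)
qed

end

theory Submission
  imports Defs
begin

text \<open>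
  The tails of a sum \<open>\<Sum>\<beta>\<^sub>i\<close> form a non-increasing sequence of ordinals, so they are eventually
  equal to some \<open>t\<close>, and the sum is a finite sum of terms followed by \<open>t\<close>. There are only countably
  many finite sums of terms. The stable tail \<open>t\<close> absorbs its terms and hence is additively
  indecomposable. If \<open>t' < t\<close> are two stable tails, then a finite sum of terms of \<open>t\<close> exceeds \<open>t'\<close>,
  so by indecomposability one of the terms is at least \<open>t'\<close>. Thus any two stable tails are separated
  by one of the \<open>\<alpha>\<^sub>i\<close>, and there are only countably many of them.
\<close>

section \<open>Ordinal arithmetic\<close>

lemma order_type_le_iff:
  "Well_order r \<Longrightarrow> Well_order s \<Longrightarrow> order_type r \<le> order_type s \<longleftrightarrow> r \<le>o s"
  by (simp add: ordIso_refl_iff less_eq_ordinal.abs_eq)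

lemma order_type_eq_iff:
  "Well_order r \<Longrightarrow> Well_order s \<Longrightarrow> order_type r = order_type s \<longleftrightarrow> r =o s"
  by (simp add: order_eq_iff order_type_le_iff ordIso_iff_ordLeq)

text \<open>Frees addition from the even/odd encoding: \<open>r\<close> and \<open>s\<close> are
  isomorphic to their copies in \<open>ord_concat\<close>, and monotonicity of \<open>Osum\<close>
  in both directions gives the isomorphism of the sums.\<close>

lemma order_type_Osum:
  assumes r: "Well_order r" and s: "Well_order s" and disj: "Field r \<inter> Field s = {}"
  shows "order_type (r Osum s) = order_type r + order_type s"
proof -
  have "r =o dir_image r (\<lambda>(n, x). (2 * n, x))" "s =o dir_image s (\<lambda>(n, x). (2 * n + 1, x))"
    using dir_image_ordIso[OF r inj_even_copy] dir_image_ordIso[OF s inj_odd_copy] .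
  then have iso: "r Osum s =o ord_concat r s"
    unfolding ordIso_iff_ordLeq ord_concat_def
    by (intro conjI Osum_mono_ordLeq disj disjoint_copies) auto
  then have "Well_order (r Osum s)" "Well_order (ord_concat r s)"
    unfolding ordIso_def by blast+
  then have "order_type (r Osum s) = order_type (ord_concat r s)"
    using iso order_type_eq_iff by blast
  also have "\<dots> = order_type r + order_type s"
    by (rule plus_ordinal.abs_eq[symmetric]) (rule ordIso_reflexive[OF r] ordIso_reflexive[OF s])+
  finally show ?thesis .
qed

text \<open>The three residue classes modulo 3 give room for three pairwise disjoint
  representatives, as associativity requires.\<close>

lemma ex_order_type_residue:
  fixes x :: "'a ordinal"
  assumes "k < 3"
  obtains r where "Well_order r" "x = order_type r" "Field r \<subseteq> {(n, a). n mod 3 = k}"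
proof -
  obtain r where r: "Well_order r" "x = order_type r"
    by (rule ex_order_type)
  define f :: "nat \<times> 'a \<Rightarrow> nat \<times> 'a" where "f = (\<lambda>(n, a). (3 * n + k, a))"
  have inj: "inj_on f A" for A
    by (auto simp: f_def inj_on_def)
  have wo: "Well_order (dir_image r f)"
    by (rule Well_order_dir_image[OF r(1) inj])
  show ?thesis
  proof (rule that[OF wo])
    show "x = order_type (dir_image r f)"
      using r wo dir_image_ordIso[OF r(1) inj] by (simp add: order_type_eq_iff)
    show "Field (dir_image r f) \<subseteq> {(n, a). n mod 3 = k}"
      using assms by (auto simp: dir_image_Field f_def)
  qed
qed

lemma ex_disjoint_order_types:
  fixes x y z :: "'a ordinal"
  obtains r s t where "Well_order r" "Well_order s" "Well_order t"
    "x = order_type r" "y = order_type s" "z = order_type t"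
    "Field r \<inter> Field s = {}" "Field r \<inter> Field t = {}" "Field s \<inter> Field t = {}"
proof -
  obtain r where r: "Well_order r" "x = order_type r" "Field r \<subseteq> {(n, a). n mod 3 = 0}"
    by (rule ex_order_type_residue[of 0]) simp
  obtain s where s: "Well_order s" "y = order_type s" "Field s \<subseteq> {(n, a). n mod 3 = 1}"
    by (rule ex_order_type_residue[of 1]) simp
  obtain t where t: "Well_order t" "z = order_type t" "Field t \<subseteq> {(n, a). n mod 3 = 2}"
    by (rule ex_order_type_residue[of 2]) simp
  have disj: "A \<inter> B = {}" if "A \<subseteq> {(n, a). n mod 3 = k}" "B \<subseteq> {(n, a). n mod 3 = l}" "k \<noteq> l"
    for A B :: "(nat \<times> 'a) set" and k l
    using that by blast
  show ?thesis
    by (rule that[OF r(1) s(1) t(1) r(2) s(2) t(2) disj[OF r(3) s(3)] disj[OF r(3) t(3)] disj[OF s(3) t(3)]])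
      simp_all
qed

instance ordinal :: (type) semigroup_add
proof
  fix x y z :: "'a ordinal"
  obtain r s t where wo: "Well_order r" "Well_order s" "Well_order t"
    and eq: "x = order_type r" "y = order_type s" "z = order_type t"
    and disj: "Field r \<inter> Field s = {}" "Field r \<inter> Field t = {}" "Field s \<inter> Field t = {}"
    by (rule ex_disjoint_order_types)
  have disj': "Field (r Osum s) \<inter> Field t = {}" "Field r \<inter> Field (s Osum t) = {}"
    using disj by (auto simp: Field_Osum)
  note wo' = Osum_Well_order[OF disj(1) wo(1,2)] Osum_Well_order[OF disj(3) wo(2,3)]
  have "x + y + z = order_type ((r Osum s) Osum t)"
    using wo wo' disj disj' by (simp add: eq order_type_Osum)
  \<comment> \<open>Both bracketings are the same relation, not merely isomorphic ones.\<close>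
  also have "(r Osum s) Osum t = r Osum (s Osum t)"
    unfolding Osum_def[of "r Osum s"] Osum_def[of r "s Osum t"] Field_Osum
    unfolding Osum_def by blast
  also have "order_type (r Osum (s Osum t)) = x + (y + z)"
    using wo wo' disj disj' by (simp add: eq order_type_Osum)
  finally show "x + y + z = x + (y + z)" .
qed

section \<open>Monotonicity, left cancellation, left subtraction and continuity of addition\<close>

lemma ordinal_add_mono:
  fixes a b c d :: "'a ordinal"
  shows "a \<le> b \<Longrightarrow> c \<le> d \<Longrightarrow> a + c \<le> b + d"
  by transfer (rule ord_concat_mono)

lemma ordinal_le_add_right:
  fixes x y :: "'a ordinal"
  shows "x \<le> x + y"
proof -
  obtain r s where wo: "Well_order r" "Well_order s"
    and eq: "x = order_type r" "y = order_type s" and disj: "Field r \<inter> Field s = {}"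
    by (rule ex_disjoint_order_types[of x y x])
  note wo' = Osum_Well_order[OF disj wo]
  have "r \<le>o r Osum s"
    unfolding ordLeq_def2
    by (intro conjI exI[of _ id] wo wo') (auto simp: Field_Osum underS_def Osum_def)
  then show ?thesis
    using wo wo' disj by (simp add: eq order_type_Osum[symmetric] order_type_le_iff)
qed

lemma ordinal_le_add_left:
  fixes x y :: "'a ordinal"
  shows "y \<le> x + y"
proof -
  obtain r s where wo: "Well_order r" "Well_order s"
    and eq: "x = order_type r" "y = order_type s" and disj: "Field r \<inter> Field s = {}"
    by (rule ex_disjoint_order_types[of x y x])
  note wo' = Osum_Well_order[OF disj wo]
  have "s \<le>o r Osum s"
    unfolding ordLeq_def2
    by (intro conjI exI[of _ id] wo wo') (auto simp: Field_Osum underS_def Osum_def)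
  then show ?thesis
    using wo wo' disj by (simp add: eq order_type_Osum[symmetric] order_type_le_iff)
qed

text \<open>
  A strictly monotone map cannot send an element of \<open>Field s\<close> into \<open>Field r\<close>, as iterating it from
  there would give an infinite descent in \<open>r\<close>.
\<close>

lemma Osum_ordLeq_cancel_left:
  assumes le: "r Osum s \<le>o r Osum t" and wo: "Well_order r" "Well_order s" "Well_order t"
    and disj: "Field r \<inter> Field s = {}" "Field r \<inter> Field t = {}"
  shows "s \<le>o t"
proof -
  obtain f where f: "\<And>a. a \<in> Field (r Osum s) \<Longrightarrow>
      f a \<in> Field (r Osum t) \<and> f ` underS (r Osum s) a \<subseteq> underS (r Osum t) (f a)"
    using le unfolding ordLeq_def2 by blast
  have mono: "(f b, f a) \<in> r Osum t \<and> f b \<noteq> f a" if "(b, a) \<in> r Osum s" "b \<noteq> a" for a b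
    using that f[of a] by (auto simp: underS_def Field_def)
  have left: "(b, a) \<in> r" if "(b, a) \<in> r Osum t" "a \<in> Field r" for a b
    using that disj(2) by (auto simp: Osum_def Field_def)
  have wf: "wf (r - Id)"
    using wo(1) by (simp add: well_order_on_def)
  have no_descent: "(f b, b) \<notin> r - Id" for b
  proof (induction b rule: wf_induct_rule[OF wf])
    case (1 b)
    show ?case
    proof
      assume fb: "(f b, b) \<in> r - Id"
      then have "(f (f b), f b) \<in> r Osum t" "f (f b) \<noteq> f b" "f b \<in> Field r"
        using mono[of "f b" b] by (auto simp: Osum_def Field_def)
      then have "(f (f b), f b) \<in> r - Id"
        using left by blast
      then show False
        using 1 fb by blast
    qed
  qed
  have ft: "f a \<in> Field t" if a: "a \<in> Field s" for a
  proof (rule ccontr)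
    assume "f a \<notin> Field t"
    then have fa: "f a \<in> Field r"
      using f[of a] a by (simp add: Field_Osum)
    \<comment> \<open>In \<open>r Osum s\<close> the element \<open>f a\<close> of
      \<open>Field r\<close> precedes \<open>a\<close>, so one more application of \<open>f\<close>
      starts the descent.\<close>
    then have "(f (f a), f a) \<in> r Osum t \<and> f (f a) \<noteq> f a"
      using a disj(1) by (intro mono) (auto simp: Osum_def)
    then show False
      using left[OF _ fa] no_descent by blast
  qed
  show ?thesis
    unfolding ordLeq_def2
  proof (intro conjI exI[of _ f] ballI wo)
    fix a assume a: "a \<in> Field s"
    show "f a \<in> Field t" by (rule ft[OF a])
    show "f ` underS s a \<subseteq> underS t (f a)"
    proof clarify
      fix b assume "b \<in> underS s a"
      then have b: "(b, a) \<in> s" "b \<noteq> a" "b \<in> Field s"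
        by (auto simp: underS_def Field_def)
      then have "(f b, f a) \<in> r Osum t \<and> f b \<noteq> f a"
        by (intro mono) (auto simp: Osum_def)
      then show "f b \<in> underS t (f a)"
        using ft[OF b(3)] disj(2) by (auto simp: Osum_def underS_def Field_def)
    qed
  qed
qed

lemma ordinal_add_le_cancel_left:
  fixes x y z :: "'a ordinal"
  assumes "x + y \<le> x + z"
  shows "y \<le> z"
proof -
  obtain r s t where wo: "Well_order r" "Well_order s" "Well_order t"
    and eq: "x = order_type r" "y = order_type s" "z = order_type t"
    and disj: "Field r \<inter> Field s = {}" "Field r \<inter> Field t = {}" "Field s \<inter> Field t = {}"
    by (rule ex_disjoint_order_types)
  have "r Osum s \<le>o r Osum t"
    using assms wo disj Osum_Well_order[OF disj(1) wo(1,2)] Osum_Well_order[OF disj(2) wo(1,3)]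
    by (simp add: eq order_type_Osum[symmetric] order_type_le_iff)
  then show ?thesis
    using Osum_ordLeq_cancel_left[OF _ wo disj(1,2)] wo by (simp add: eq order_type_le_iff)
qed

text \<open>A representative of \<open>x\<close> embeds onto an initial segment \<open>A\<close> of
  one of \<open>z\<close>; the remainder above \<open>A\<close> has the required order type.\<close>

lemma ordinal_le_imp_ex_add:
  fixes x z :: "'a ordinal"
  assumes "x \<le> z"
  obtains y where "z = x + y"
proof -
  obtain r where r: "Well_order r" "x = order_type r" by (rule ex_order_type)
  obtain t where t: "Well_order t" "z = order_type t" by (rule ex_order_type)
  have "r \<le>o t"
    using assms r t by (simp add: order_type_le_iff)
  then obtain f where f: "embed r t f"
    unfolding ordLeq_def by blast
  define A where "A = f ` Field r"
  have A: "wo_rel.ofilter t A"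
    unfolding A_def using embed_Field_ofilter[OF r(1) t(1) f] .
  have rA: "r =o Restr t A"
    unfolding A_def ordIso_def
    using embed_implies_iso_Restr[OF t(1) r(1) f] r(1) Well_order_Restr[OF t(1)] by blast
  have FA: "Field (Restr t A) = A"
    using A t(1) by (simp add: Field_Restr_ofilter)
  have FB: "Field (Restr t (Field t - A)) = Field t - A"
    using t(1) by (simp add: Refl_Field_Restr2 order_on_defs)
  have wo: "Well_order (Restr t A)" "Well_order (Restr t (Field t - A))"
    using t(1) by (simp_all add: Well_order_Restr)
  have down: "a \<in> A" if "(a, b) \<in> t" "b \<in> A" for a b
    using A that t(1) by (auto simp: wo_rel_def wo_rel.ofilter_def under_def)
  have up: "(a, b) \<in> t" if "a \<in> A" "b \<in> Field t - A" for a b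
  proof -
    have "a \<in> Field t" "a \<noteq> b" "Total t"
      using A that t(1) by (auto simp: wo_rel_def wo_rel.ofilter_def order_on_defs)
    then show ?thesis
      using that down unfolding total_on_def by blast
  qed
  have "Restr t A Osum Restr t (Field t - A) = t" (is "?s = t")
  proof (rule Set.set_eqI)
    fix p :: "(nat \<times> 'a) \<times> (nat \<times> 'a)"
    obtain a b where p: "p = (a, b)" by (rule prod.exhaust)
    have "(a, b) \<in> t \<Longrightarrow> a \<in> Field t \<and> b \<in> Field t"
      by (simp add: FieldI1 FieldI2)
    then show "p \<in> ?s \<longleftrightarrow> p \<in> t"
      unfolding p Osum_def FA FB using down[of a b] up[of a b] by blast
  qed
  moreover have "Field (Restr t A) \<inter> Field (Restr t (Field t - A)) = {}"
    unfolding FA FB by blast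
  ultimately have "z = order_type (Restr t A) + order_type (Restr t (Field t - A))"
    using order_type_Osum[OF wo] t(2) by argo
  also have "order_type (Restr t A) = x"
    using order_type_eq_iff[THEN iffD2, OF r(1) wo(1) rA] r(2) by simp
  finally show ?thesis
    by (rule that)
qed

text \<open>The supremum on the right is at least \<open>x\<close>, so it has the form
  \<open>x + v\<close>. Left cancellation turns its being an upper bound into
  \<open>q n \<le> v\<close> for all \<open>n\<close>.\<close>

lemma ordinal_add_SUP:
  fixes x :: "'a ordinal" and q :: "nat \<Rightarrow> 'a ordinal"
  shows "x + (SUP n. q n) = (SUP n. x + q n)"
proof (rule antisym)
  have ub: "x + q n \<le> (SUP n. x + q n)" for n
    by (intro cSUP_upper bdd_above_ordinal_sequence UNIV_I)
  obtain v where v: "(SUP n. x + q n) = x + v"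
    using ordinal_le_imp_ex_add ub[of 0] ordinal_le_add_right order_trans by metis
  have "(SUP n. q n) \<le> v"
    using ub unfolding v by (intro cSUP_least) (auto intro: ordinal_add_le_cancel_left)
  then show "x + (SUP n. q n) \<le> (SUP n. x + q n)"
    unfolding v by (intro ordinal_add_mono order_refl)
  show "(SUP n. x + q n) \<le> x + (SUP n. q n)"
    by (intro cSUP_least ordinal_add_mono cSUP_upper bdd_above_ordinal_sequence) auto
qed


section \<open>Tails of sums\<close>

lemma partial_sum_Suc_shift: "partial_sum \<beta> (Suc n) = \<beta> 0 + partial_sum (\<lambda>i. \<beta> (Suc i)) n"
  by (induction n) (simp_all add: add.assoc)

lemma ordinal_sum_shift: "ordinal_sum \<beta> = \<beta> 0 + ordinal_sum (\<lambda>i. \<beta> (Suc i))"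
proof -
  have "ordinal_sum \<beta> = (SUP n. partial_sum \<beta> (Suc n))"
    unfolding ordinal_sum_def
  proof (rule antisym)
    show "(SUP n. partial_sum \<beta> n) \<le> (SUP n. partial_sum \<beta> (Suc n))"
    proof (rule cSUP_least)
      fix n
      have "partial_sum \<beta> n \<le> partial_sum \<beta> (Suc n)"
        by (simp add: ordinal_le_add_right)
      also have "\<dots> \<le> (SUP n. partial_sum \<beta> (Suc n))"
        by (intro cSUP_upper bdd_above_ordinal_sequence UNIV_I)
      finally show "partial_sum \<beta> n \<le> (SUP n. partial_sum \<beta> (Suc n))" .
    qed simp
    show "(SUP n. partial_sum \<beta> (Suc n)) \<le> (SUP n. partial_sum \<beta> n)"
      by (intro cSUP_least cSUP_upper bdd_above_ordinal_sequence) auto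
  qed
  then show ?thesis
    unfolding partial_sum_Suc_shift ordinal_add_SUP[symmetric] ordinal_sum_def .
qed

text \<open>With \<open>foldr\<close> the finite prefix becomes a map applied to the tail. Later
  this map is determined by a list of indices, of which there are countably many.\<close>

lemma ordinal_sum_split:
  "ordinal_sum \<beta> = foldr (\<lambda>i x. \<beta> i + x) [0..<n] (ordinal_sum (\<lambda>i. \<beta> (n + i)))"
proof (induction n)
  case (Suc n)
  then show ?case
    using ordinal_sum_shift[of "\<lambda>i. \<beta> (n + i)"] by simp
qed simp

lemma ordinal_sum_eventually_stable:
  fixes \<beta> :: "nat \<Rightarrow> 'a ordinal"
  obtains N where "\<And>n. \<beta> (N + n) + ordinal_sum (\<lambda>i. \<beta> (N + i)) = ordinal_sum (\<lambda>i. \<beta> (N + i))"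
proof -
  define t where "t n = ordinal_sum (\<lambda>i. \<beta> (n + i))" for n
  have t: "t n = \<beta> n + t (Suc n)" for n
    using ordinal_sum_shift[of "\<lambda>i. \<beta> (n + i)"] by (simp add: t_def)
  \<comment> \<open>By well-foundedness some tail has the least value; being non-increasing, the
    tails are constant from there on.\<close>
  obtain N where N: "\<And>n. t N \<le> t n"
    using LeastI_ex[of "\<lambda>x. \<exists>n. x = t n"] Least_le[of "\<lambda>x. \<exists>n. x = t n"] by metis
  have "t (N + n) = t N" for n
  proof (induction n)
    case (Suc n)
    have "t (N + Suc n) \<le> t (N + n)"
      using t[of "N + n"] ordinal_le_add_left by simp
    then show ?case
      using Suc N by (simp add: antisym)
  qed simp
  \<comment> \<open>The tails at \<open>N + n\<close> and at its successor both equal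
    \<open>t N\<close>.\<close>
  then have "\<beta> (N + n) + t N = t N" for n
    using t[of "N + n"] by (metis add_Suc_right)
  then show ?thesis
    by (intro that[of N]) (simp add: t_def)
qed

lemma partial_sum_absorbed:
  assumes "\<And>i. \<beta> i + t = t"
  shows "partial_sum \<beta> n + t = t"
  using assms by (induction n) (simp_all add: add.assoc)

section \<open>Stable tails\<close>

text \<open>The shift by \<open>N\<close> from the preceding stabilization is absorbed into the
  index map \<phi>, so a stable tail is itself a sum over an index map that absorbs each of its
  terms from the left.\<close>

definition stable_tails :: "(nat \<Rightarrow> 'a ordinal) \<Rightarrow> 'a ordinal set" where
  "stable_tails \<alpha> = {ordinal_sum (\<lambda>i. \<alpha> (\<phi> i)) | \<phi> :: nat \<Rightarrow> nat.
      \<forall>i. \<alpha> (\<phi> i) + ordinal_sum (\<lambda>i. \<alpha> (\<phi> i)) = ordinal_sum (\<lambda>i. \<alpha> (\<phi> i))}"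

text \<open>Any \<open>x < t\<close> lies below some partial sum of \<open>t\<close>, and
  \<open>t\<close> absorbs that partial sum term by term.\<close>

lemma stable_tail_indecomposable:
  assumes t: "t \<in> stable_tails \<alpha>" and x: "x < t"
  shows "x + t = t"
proof (rule antisym[OF _ ordinal_le_add_left])
  obtain \<phi> where \<phi>: "t = ordinal_sum (\<lambda>i. \<alpha> (\<phi> i))" "\<And>i. \<alpha> (\<phi> i) + t = t"
    using t unfolding stable_tails_def by auto
  obtain n where n: "x < partial_sum (\<lambda>i. \<alpha> (\<phi> i)) n"
    using x bdd_above_ordinal_sequence unfolding \<phi>(1) ordinal_sum_def
    by (subst (asm) less_cSUP_iff) auto
  have "x + t \<le> partial_sum (\<lambda>i. \<alpha> (\<phi> i)) n + t"
    using n by (intro ordinal_add_mono) auto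
  also have "\<dots> = t"
    by (intro partial_sum_absorbed \<phi>(2))
  finally show "x + t \<le> t" .
qed

lemma stable_tails_separated:
  assumes t: "t \<in> stable_tails \<alpha>" and u: "u \<in> stable_tails \<alpha>" and less: "u < t"
  shows "\<exists>j. u \<le> \<alpha> j \<and> \<alpha> j < t"
proof -
  obtain \<phi> where \<phi>: "t = ordinal_sum (\<lambda>i. \<alpha> (\<phi> i))" "\<And>i. \<alpha> (\<phi> i) + t = t"
    using t unfolding stable_tails_def by auto
  obtain n where n: "u < partial_sum (\<lambda>i. \<alpha> (\<phi> i)) n"
    using less bdd_above_ordinal_sequence unfolding \<phi>(1) ordinal_sum_def
    by (subst (asm) less_cSUP_iff) auto
  \<comment> \<open>Otherwise \<open>u\<close> would absorb every term and hence the partial sum,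
    which would then be at most \<open>u\<close>.\<close>
  have "\<exists>i. u \<le> \<alpha> (\<phi> i)"
  proof (rule ccontr)
    assume "\<not> ?thesis"
    then have "\<alpha> (\<phi> i) + u = u" for i
      using stable_tail_indecomposable[OF u] by (simp add: not_le)
    then have "partial_sum (\<lambda>i. \<alpha> (\<phi> i)) n + u = u"
      by (rule partial_sum_absorbed)
    then show False
      using n ordinal_le_add_right by (metis not_le)
  qed
  \<comment> \<open>A term that is at least \<open>t\<close> would give
    \<open>t + t \<le> t \<le> t + u\<close>, and cancelling \<open>t\<close> contradicts
    \<open>u < t\<close>.\<close>
  moreover have "\<alpha> (\<phi> i) < t" for i
  proof (rule ccontr)
    assume "\<not> ?thesis"
    then have "t + t \<le> \<alpha> (\<phi> i) + t"
      by (intro ordinal_add_mono) auto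
    also have "\<dots> \<le> t + u"
      by (simp add: \<phi>(2) ordinal_le_add_right)
    finally show False
      using ordinal_add_le_cancel_left less by (metis not_le)
  qed
  ultimately show ?thesis by blast
qed

section \<open>Countability\<close>

text \<open>Send \<open>u\<close> to the least member of the sequence that is at least
  \<open>u\<close>. By separation this value lies below every larger element of \<open>A\<close>, so
  the map is injective away from a maximum.\<close>

lemma countable_if_separated:
  fixes A :: "'b :: wellorder set" and a :: "nat \<Rightarrow> 'b"
  assumes sep: "\<And>u t. u \<in> A \<Longrightarrow> t \<in> A \<Longrightarrow> u < t \<Longrightarrow> \<exists>j. u \<le> a j \<and> a j < t"
  shows "countable A"
proof -
  \<comment> \<open>all of \<open>A\<close> except its maximum, for which \<open>f\<close> below may be a junk value\<close>
  define B where "B = {u \<in> A. \<exists>t\<in>A. u < t}"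
  define f where "f u = (LEAST x. \<exists>j. x = a j \<and> u \<le> x)" for u
  have f: "u \<le> f u \<and> f u < t \<and> f u \<in> range a" if less: "u \<in> A" "t \<in> A" "u < t" for u t
  proof -
    obtain j where j: "u \<le> a j" "a j < t"
      using sep less by blast
    have "\<exists>j. f u = a j \<and> u \<le> f u"
      unfolding f_def by (rule LeastI_ex) (use j in auto)
    moreover have "f u \<le> a j"
      unfolding f_def by (rule Least_le) (use j in auto)
    ultimately show ?thesis
      using j by auto
  qed
  have "inj_on f B"
    unfolding B_def
  proof (rule linorder_inj_onI)
    fix u t assume less: "u < t" and "u \<in> {u \<in> A. \<exists>t\<in>A. u < t}" "t \<in> {u \<in> A. \<exists>t\<in>A. u < t}"
    then have "f u < t" "t \<le> f t"
      using f by blast+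
    then show "f u \<noteq> f t" by simp
  qed auto
  moreover have "f ` B \<subseteq> range a"
    unfolding B_def using f by blast
  then have "countable (f ` B)"
    by (rule countable_subset) simp
  ultimately have "countable B"
    by (metis countable_image_inj_on)
  moreover have "countable (A - B)"
  proof (cases "\<exists>m. m \<in> A - B")
    case True
    then obtain m where "m \<in> A - B" by blast
    \<comment> \<open>Of two distinct elements of \<open>A\<close> the smaller belongs to
      \<open>B\<close>.\<close>
    then have "A - B \<subseteq> {m}"
      unfolding B_def by (auto simp: not_less intro: order.antisym)
    then show ?thesis
      by (rule countable_subset) simp
  next
    case False
    then have "A - B = {}" by blast
    then show ?thesis by (metis countable_empty)
  qed
  ultimately have "countable (B \<union> (A - B))"
    by (rule countable_Un)
  then show ?thesis
    by (rule countable_subset[rotated]) blast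
qed

theorem corollary2p2:
  fixes \<alpha> :: "nat \<Rightarrow> 'a ordinal"
  shows "countable {ordinal_sum (\<lambda>i. \<alpha> (\<phi> i)) | \<phi> :: nat \<Rightarrow> nat. inj \<phi>}"
proof (rule countable_subset)
  have "countable (stable_tails \<alpha>)"
    by (rule countable_if_separated[where a = \<alpha>]) (rule stable_tails_separated)
  \<comment> \<open>\<open>js\<close> ranges over all lists of natural numbers, a countable type,
    and each list contributes an image of the countable set of stable tails.\<close>
  then show "countable (\<Union>js. foldr (\<lambda>j x. \<alpha> j + x) js ` stable_tails \<alpha>)"
    by (intro countable_UN countable_image) auto
  show "{ordinal_sum (\<lambda>i. \<alpha> (\<phi> i)) | \<phi> :: nat \<Rightarrow> nat. inj \<phi>}
      \<subseteq> (\<Union>js. foldr (\<lambda>j x. \<alpha> j + x) js ` stable_tails \<alpha>)"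
  proof clarify
    fix \<phi> :: "nat \<Rightarrow> nat"
    obtain N where N: "\<And>n. \<alpha> (\<phi> (N + n)) + ordinal_sum (\<lambda>i. \<alpha> (\<phi> (N + i))) =
        ordinal_sum (\<lambda>i. \<alpha> (\<phi> (N + i)))"
      using ordinal_sum_eventually_stable[of "\<lambda>i. \<alpha> (\<phi> i)"] by blast
    then have "ordinal_sum (\<lambda>i. \<alpha> (\<phi> (N + i))) \<in> stable_tails \<alpha>"
      unfolding stable_tails_def by (intro CollectI exI[of _ "\<lambda>i. \<phi> (N + i)"]) simp
    moreover have "ordinal_sum (\<lambda>i. \<alpha> (\<phi> i)) =
        foldr (\<lambda>j x. \<alpha> j + x) (map \<phi> [0..<N]) (ordinal_sum (\<lambda>i. \<alpha> (\<phi> (N + i))))"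
      using ordinal_sum_split[of "\<lambda>i. \<alpha> (\<phi> i)" N] by (simp add: foldr_map comp_def)
    ultimately show "ordinal_sum (\<lambda>i. \<alpha> (\<phi> i)) \<in> (\<Union>js. foldr (\<lambda>j x. \<alpha> j + x) js ` stable_tails \<alpha>)"
      by blast
  qed
qed

end
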